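(* There exists a unique unital algebra homomorphism $\natural:\mathcal H\to U(\mathfrak{sl}_2)\otimes U(\mathfrak{sl}_2)$ that sends $$A\mapsto \frac{H\otimes 1-1\otimes H}{4},\qquad B\mapsto \frac{\Delta(\Lambda)}{2},\qquad C\mapsto E\otimes F-F\otimes E.$$ Moreover $\natural$ sends $$\alpha\mapsto \frac{\Lambda\otimes 1+1\otimes \Lambda}{2}+\frac{\Delta(H)^2}{8},\qquad \beta\mapsto \frac{(\Lambda\otimes 1-1\otimes \Lambda)\Delta(H)}{2}.$$
   Context: All algebras are unital associative algebras over $\mathbb C$; $[x,y]=xy-yx$; $\otimes$ is over $\mathbb C$. $U(\mathfrak{sl}_2)$ is the algebra generated by $E,F,H$ with relations $[H,E]=2E$, $[H,F]=-2F$, $[E,F]=H$. Its Casimir element is $\Lambda=EF+FE+\frac{H^2}{2}$. The comultiplication $\Delta:U(\mathfrak{sl}_2)\to U(\mathfrak{sl}_2)\otimes U(\mathfrak{sl}_2)$ is the algebra homomorphism with $\Delta(X)=X\otimes 1+1\otimes X$ for $X\in\{E,F,H\}$. The universal Hahn algebra $\mathcal H$ is the algebra generated by $A,B,C$ subject to the relations $[A,B]=C$ and that each of $\alpha:=[C,A]+2A^2+B$ and $\beta:=[B,C]+4BA+2C$ is central in $\mathcal H$. *)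

theory Defs
  imports Complex_Main "HOL-Library.Poly_Mapping"
begin

section \<open>Unital associative algebras over the complex numbers\<close>

text \<open>The class \<open>ring_1\<close> is avoided because it demands \<open>0 \<noteq> 1\<close>, which need not hold in a
  general algebra given by generators and relations or in a general tensor product.\<close>

class calgebra = ring + monoid_mult +
  fixes scaleC :: "complex \<Rightarrow> 'a \<Rightarrow> 'a"  (infixr \<open>*\<^sub>C\<close> 75)
  assumes scaleC_add_right: "c *\<^sub>C (x + y) = c *\<^sub>C x + c *\<^sub>C y"
    and scaleC_add_left: "(c + d) *\<^sub>C x = c *\<^sub>C x + d *\<^sub>C x"
    and scaleC_scaleC: "c *\<^sub>C d *\<^sub>C x = (c * d) *\<^sub>C x"
    and scaleC_one: "1 *\<^sub>C x = x"
    and mult_scaleC_left: "(c *\<^sub>C x) * y = c *\<^sub>C (x * y)"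
    and mult_scaleC_right: "x * (c *\<^sub>C y) = c *\<^sub>C (x * y)"

interpretation calgebra: vector_space "scaleC :: complex \<Rightarrow> 'a::calgebra \<Rightarrow> 'a"
  by unfold_locales (simp_all add: scaleC_add_right scaleC_add_left scaleC_scaleC scaleC_one)

definition alg_hom :: "('a::calgebra \<Rightarrow> 'b::calgebra) \<Rightarrow> bool" where
  "alg_hom f \<longleftrightarrow>
     f 1 = 1 \<and>
     (\<forall>x y. f (x + y) = f x + f y) \<and>
     (\<forall>x y. f (x * y) = f x * f y) \<and>
     (\<forall>c x. f (c *\<^sub>C x) = c *\<^sub>C f x)"

definition commutator :: "'a::ring \<Rightarrow> 'a \<Rightarrow> 'a" where
  "commutator x y = x * y - y * x"

instantiation complex :: calgebra
begin

definition scaleC_complex :: "complex \<Rightarrow> complex \<Rightarrow> complex" where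
  "scaleC_complex c x = c * x"

instance
  by standard (simp_all add: scaleC_complex_def algebra_simps)

end


section \<open>Monoid algebras\<close>

text \<open>For a monoid \<open>'k\<close>, written additively as \<open>Poly_Mapping\<close> requires, the type
  \<open>'k \<Rightarrow>\<^sub>0 complex\<close> with its convolution product is the monoid algebra of \<open>'k\<close>.\<close>

lemma poly_mapping_induct_add [case_names zero single add]:
  fixes p :: "'k \<Rightarrow>\<^sub>0 'b::comm_monoid_add"
  assumes "P 0" "\<And>k c. P (Poly_Mapping.single k c)" "\<And>p q. P p \<Longrightarrow> P q \<Longrightarrow> P (p + q)"
  shows "P p"
proof (induction p rule: update_induct)
  case const
  show ?case by fact
next
  case (update f a b)
  have "Poly_Mapping.update a b f = f + Poly_Mapping.single a b"
    using update(1)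
    by (intro poly_mapping_eqI)
       (auto simp: lookup_update lookup_add lookup_single when_def in_keys_iff)
  then show ?case using assms(2,3) update by simp
qed

instantiation poly_mapping :: (monoid_add, "{calgebra, ring_1}") calgebra
begin

lift_definition scaleC_poly_mapping :: "complex \<Rightarrow> ('a \<Rightarrow>\<^sub>0 'b) \<Rightarrow> 'a \<Rightarrow>\<^sub>0 'b"
  is "\<lambda>c f k. c *\<^sub>C f k"
  by (rule finite_subset[rotated], assumption) auto

lemma lookup_scaleC: "Poly_Mapping.lookup (c *\<^sub>C p) k = c *\<^sub>C Poly_Mapping.lookup p k"
  by transfer simp

lemma scaleC_single: "c *\<^sub>C Poly_Mapping.single k d = Poly_Mapping.single k (c *\<^sub>C d)"
  by (rule poly_mapping_eqI) (simp add: lookup_scaleC lookup_single when_def)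

instance
proof
  fix c d :: complex and x y :: "'a \<Rightarrow>\<^sub>0 'b"
  show add: "c *\<^sub>C (x + y) = c *\<^sub>C x + c *\<^sub>C y" for c :: complex and x y :: "'a \<Rightarrow>\<^sub>0 'b"
    by (rule poly_mapping_eqI) (simp add: lookup_scaleC lookup_add scaleC_add_right)
  show "(c + d) *\<^sub>C x = c *\<^sub>C x + d *\<^sub>C x"
    by (rule poly_mapping_eqI) (simp add: lookup_scaleC lookup_add scaleC_add_left)
  show "c *\<^sub>C d *\<^sub>C x = (c * d) *\<^sub>C x"
    by (rule poly_mapping_eqI) (simp add: lookup_scaleC)
  show "1 *\<^sub>C x = x"
    by (rule poly_mapping_eqI) (simp add: lookup_scaleC)
  have zero: "c *\<^sub>C (0 :: 'a \<Rightarrow>\<^sub>0 'b) = 0"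
    by (rule poly_mapping_eqI) (simp add: lookup_scaleC)
  have left: "(c *\<^sub>C Poly_Mapping.single k e) * y = c *\<^sub>C (Poly_Mapping.single k e * y)"
    for k :: 'a and e :: 'b and y
    by (induction y rule: poly_mapping_induct_add)
       (simp_all add: zero add scaleC_single mult_single mult_scaleC_left distrib_left)
  show "(c *\<^sub>C x) * y = c *\<^sub>C (x * y)"
    by (induction x rule: poly_mapping_induct_add)
       (simp_all add: zero add left distrib_right)
  have right: "Poly_Mapping.single k e * (c *\<^sub>C y) = c *\<^sub>C (Poly_Mapping.single k e * y)"
    for k :: 'a and e :: 'b and y
    by (induction y rule: poly_mapping_induct_add)
       (simp_all add: zero add scaleC_single mult_single mult_scaleC_right distrib_left)
  show "x * (c *\<^sub>C y) = c *\<^sub>C (x * y)"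
    by (induction x rule: poly_mapping_induct_add)
       (simp_all add: zero add right distrib_right)
qed

end

text \<open>The linear extension of a map on the monoid.\<close>

definition lin_ext :: "('k \<Rightarrow> 'a::calgebra) \<Rightarrow> ('k \<Rightarrow>\<^sub>0 complex) \<Rightarrow> 'a" where
  "lin_ext g p = (\<Sum>k \<in> Poly_Mapping.keys p. Poly_Mapping.lookup p k *\<^sub>C g k)"

lemma lin_ext_superset:
  assumes "finite K" "Poly_Mapping.keys p \<subseteq> K"
  shows "lin_ext g p = (\<Sum>k \<in> K. Poly_Mapping.lookup p k *\<^sub>C g k)"
  unfolding lin_ext_def
  by (rule sum.mono_neutral_left) (use assms in \<open>auto simp: in_keys_iff\<close>)

lemma lin_ext_zero [simp]: "lin_ext g 0 = 0"
  by (simp add: lin_ext_def)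

lemma lin_ext_single [simp]: "lin_ext g (Poly_Mapping.single k c) = c *\<^sub>C g k"
  by (subst lin_ext_superset[of "{k}"]) auto

lemma lin_ext_add: "lin_ext g (p + q) = lin_ext g p + lin_ext g q"
proof -
  let ?K = "Poly_Mapping.keys p \<union> Poly_Mapping.keys q"
  have "Poly_Mapping.keys (p + q) \<subseteq> ?K" by (rule Poly_Mapping.keys_add)
  then show ?thesis
    by (simp add: lin_ext_superset[of ?K] lookup_add scaleC_add_left sum.distrib)
qed

lemma lin_ext_scaleC:
  fixes p :: "'k::monoid_add \<Rightarrow>\<^sub>0 complex"
  shows "lin_ext g (c *\<^sub>C p) = c *\<^sub>C lin_ext g p"
  by (induction p rule: poly_mapping_induct_add)
     (simp_all add: scaleC_single lin_ext_add scaleC_add_right scaleC_complex_def)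

lemma alg_hom_lin_ext:
  fixes g :: "'k::monoid_add \<Rightarrow> 'a::calgebra"
  assumes "g 0 = 1" "\<And>k l. g (k + l) = g k * g l"
  shows "alg_hom (lin_ext g)"
proof -
  have single: "lin_ext g (Poly_Mapping.single k c * q) = (c *\<^sub>C g k) * lin_ext g q" for k c q
    by (induction q rule: poly_mapping_induct_add)
       (simp_all add: mult_single lin_ext_add assms distrib_left mult_scaleC_left mult_scaleC_right mult.commute)
  have mult: "lin_ext g (p * q) = lin_ext g p * lin_ext g q" for p q
    by (induction p rule: poly_mapping_induct_add)
       (simp_all add: single lin_ext_add distrib_right)
  have "lin_ext g 1 = 1"
    using assms(1) by (simp flip: single_one)
  with mult show ?thesis
    by (simp add: alg_hom_def lin_ext_add lin_ext_scaleC)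
qed


section \<open>Algebras given by generators and relations\<close>

datatype 'x free_monoid = Free_Monoid (letters: "'x list")

instantiation free_monoid :: (type) monoid_add
begin

definition zero_free_monoid :: "'a free_monoid" where
  "zero_free_monoid = Free_Monoid []"

definition plus_free_monoid :: "'a free_monoid \<Rightarrow> 'a free_monoid \<Rightarrow> 'a free_monoid" where
  "plus_free_monoid v w = Free_Monoid (letters v @ letters w)"

instance
  by standard (simp_all add: zero_free_monoid_def plus_free_monoid_def)

end

type_synonym 'x free_algebra = "'x free_monoid \<Rightarrow>\<^sub>0 complex"

definition free_gen :: "'x \<Rightarrow> 'x free_algebra" where
  "free_gen x = Poly_Mapping.single (Free_Monoid [x]) 1"

definition free_lift :: "('x \<Rightarrow> 'a::calgebra) \<Rightarrow> 'x free_algebra \<Rightarrow> 'a" where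
  "free_lift f = lin_ext (\<lambda>w. prod_list (map f (letters w)))"

lemma alg_hom_free_lift: "alg_hom (free_lift f)"
  unfolding free_lift_def
  by (rule alg_hom_lin_ext) (simp_all add: zero_free_monoid_def plus_free_monoid_def)

lemma free_lift_gen [simp]: "free_lift f (free_gen x) = f x"
  by (simp add: free_lift_def free_gen_def)

lemma single_eq_prod_free_gen:
  "Poly_Mapping.single (Free_Monoid xs) c = c *\<^sub>C prod_list (map free_gen xs)"
proof (induction xs arbitrary: c)
  case Nil
  show ?case
    by (simp add: scaleC_single scaleC_complex_def flip: zero_free_monoid_def single_one)
next
  case (Cons x xs)
  have "Poly_Mapping.single (Free_Monoid (x # xs)) c =
      free_gen x * Poly_Mapping.single (Free_Monoid xs) c"
    by (simp add: free_gen_def mult_single plus_free_monoid_def)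
  with Cons show ?case by (simp add: mult_scaleC_right)
qed

text \<open>The two-sided ideal generated by a subset of a unital algebra. It is a linear subspace, as
  scalar multiplication by \<open>c\<close> is multiplication by \<open>c *\<^sub>C 1\<close>.\<close>

inductive_set two_sided_ideal :: "'a::calgebra set \<Rightarrow> 'a set" for R where
  zero: "0 \<in> two_sided_ideal R"
| base: "r \<in> R \<Longrightarrow> r \<in> two_sided_ideal R"
| add: "x \<in> two_sided_ideal R \<Longrightarrow> y \<in> two_sided_ideal R \<Longrightarrow> x + y \<in> two_sided_ideal R"
| left: "x \<in> two_sided_ideal R \<Longrightarrow> a * x \<in> two_sided_ideal R"
| right: "x \<in> two_sided_ideal R \<Longrightarrow> x * a \<in> two_sided_ideal R"

lemma two_sided_ideal_uminus: "x \<in> two_sided_ideal R \<Longrightarrow> - x \<in> two_sided_ideal R"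
  using two_sided_ideal.left[of x R "- 1"] by simp

lemma two_sided_ideal_diff:
  "x \<in> two_sided_ideal R \<Longrightarrow> y \<in> two_sided_ideal R \<Longrightarrow> x - y \<in> two_sided_ideal R"
  using two_sided_ideal.add[OF _ two_sided_ideal_uminus] by fastforce

lemma two_sided_ideal_scaleC: "x \<in> two_sided_ideal R \<Longrightarrow> c *\<^sub>C x \<in> two_sided_ideal R"
  using two_sided_ideal.left[of x R "c *\<^sub>C 1"] by (simp add: mult_scaleC_left)

text \<open>A presentation is attached to the type of its generators: an instance fixes the set of those
  elements of the free algebra that are to become zero, and \<open>'x presented\<close> is the quotient of the
  free algebra by the two-sided ideal they generate.\<close>

class presentation =
  fixes relators :: "'a free_algebra set"

definition presented_eq :: "'x::presentation free_algebra \<Rightarrow> 'x free_algebra \<Rightarrow> bool" where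
  "presented_eq p q \<longleftrightarrow> p - q \<in> two_sided_ideal relators"

quotient_type (overloaded) 'x presented = "'x::presentation free_algebra" / presented_eq
proof (rule equivpI)
  show "reflp presented_eq"
    by (auto simp: reflp_def presented_eq_def two_sided_ideal.zero)
  show "symp presented_eq"
    by (auto simp: symp_def presented_eq_def dest: two_sided_ideal_uminus)
  show "transp presented_eq"
    by (auto simp: transp_def presented_eq_def dest: two_sided_ideal.add)
qed

instantiation presented :: (presentation) calgebra
begin

lift_definition zero_presented :: "'a presented" is 0 .

lift_definition one_presented :: "'a presented" is 1 .

lift_definition plus_presented :: "'a presented \<Rightarrow> 'a presented \<Rightarrow> 'a presented" is "(+)"
  unfolding presented_eq_def by (drule (1) two_sided_ideal.add) (simp add: algebra_simps)

lift_definition uminus_presented :: "'a presented \<Rightarrow> 'a presented" is uminus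
  unfolding presented_eq_def by (drule two_sided_ideal_uminus) simp

lift_definition minus_presented :: "'a presented \<Rightarrow> 'a presented \<Rightarrow> 'a presented" is "(-)"
  unfolding presented_eq_def by (drule (1) two_sided_ideal_diff) (simp add: algebra_simps)

lift_definition times_presented :: "'a presented \<Rightarrow> 'a presented \<Rightarrow> 'a presented" is "(*)"
proof -
  fix p p' q q' :: "'a free_algebra"
  assume "presented_eq p p'" "presented_eq q q'"
  then have "(p - p') * q + p' * (q - q') \<in> two_sided_ideal relators"
    by (auto simp: presented_eq_def intro: two_sided_ideal.intros)
  then show "presented_eq (p * q) (p' * q')"
    by (simp add: presented_eq_def algebra_simps)
qed

lift_definition scaleC_presented :: "complex \<Rightarrow> 'a presented \<Rightarrow> 'a presented" is scaleC
  unfolding presented_eq_def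
  by (drule two_sided_ideal_scaleC) (simp add: calgebra.scale_right_diff_distrib)

instance
  by standard (transfer; simp add: presented_eq_def two_sided_ideal.zero algebra_simps
    scaleC_add_right scaleC_add_left mult_scaleC_left mult_scaleC_right)+

end

lift_definition gen :: "'x \<Rightarrow> 'x::presentation presented" is free_gen .

lemma alg_hom_abs_presented: "alg_hom abs_presented"
  by (simp add: alg_hom_def one_presented_def plus_presented.abs_eq times_presented.abs_eq
      scaleC_presented.abs_eq)

lemma abs_presented_free_gen [simp]: "abs_presented (free_gen x) = gen x"
  by (simp add: gen.abs_eq)

lemma alg_hom_eq_zero_on_ideal:
  assumes "alg_hom f" "\<And>r. r \<in> R \<Longrightarrow> f r = 0" "x \<in> two_sided_ideal R"
  shows "f x = 0"
proof -
  have "f 0 = 0"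
    using assms(1) unfolding alg_hom_def by (metis add_cancel_right_right)
  with assms(3) show ?thesis
    by induction (use assms(1,2) in \<open>simp_all add: alg_hom_def\<close>)
qed

lemma alg_hom_diff: "alg_hom f \<Longrightarrow> f (x - y) = f x - f y"
  unfolding alg_hom_def by (metis add_diff_cancel diff_add_cancel)

lemma alg_hom_presented_ext:
  fixes f g :: "'x::presentation presented \<Rightarrow> 'a::calgebra"
  assumes f: "alg_hom f" and g: "alg_hom g" and gen: "\<And>x. f (gen x) = g (gen x)"
  shows "f = g"
proof -
  have prod: "f (abs_presented (prod_list (map free_gen xs))) =
      g (abs_presented (prod_list (map free_gen xs)))" for xs
    using f g gen
    by (induction xs) (simp_all add: alg_hom_def alg_hom_abs_presented[unfolded alg_hom_def])
  have zero: "f 0 = 0" "g 0 = 0"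
    using f g alg_hom_diff[of f 0 0] alg_hom_diff[of g 0 0] by simp_all
  have single: "f (abs_presented (Poly_Mapping.single w c)) =
      g (abs_presented (Poly_Mapping.single w c))" for w c
    using f g prod
    by (cases w)
       (simp add: alg_hom_def single_eq_prod_free_gen alg_hom_abs_presented[unfolded alg_hom_def])
  have "f (abs_presented p) = g (abs_presented p)" for p
    using f g zero single
    by (induction p rule: poly_mapping_induct_add)
       (simp_all add: alg_hom_def alg_hom_abs_presented[unfolded alg_hom_def]
         flip: zero_presented_def)
  then show ?thesis
    by (metis Quotient_abs_rep Quotient_presented ext)
qed


section \<open>Tensor product of algebras\<close>

text \<open>The componentwise multiplicative monoid structure on pairs, written additively so that the
  monoid algebra is the free vector space on pairs with \<open>(a, b) \<cdot> (a', b') = (a a', b b')\<close>.\<close>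

datatype ('a, 'b) mult_pair = Mult_Pair 'a 'b

instantiation mult_pair :: (monoid_mult, monoid_mult) monoid_add
begin

definition zero_mult_pair :: "('a, 'b) mult_pair" where
  "zero_mult_pair = Mult_Pair 1 1"

fun plus_mult_pair :: "('a, 'b) mult_pair \<Rightarrow> ('a, 'b) mult_pair \<Rightarrow> ('a, 'b) mult_pair" where
  "plus_mult_pair (Mult_Pair a b) (Mult_Pair a' b') = Mult_Pair (a * a') (b * b')"

instance
proof
  fix x y z :: "('a, 'b) mult_pair"
  show "x + y + z = x + (y + z)"
    by (cases x; cases y; cases z) (simp add: mult.assoc)
  show "0 + x = x" "x + 0 = x"
    by (cases x; simp add: zero_mult_pair_def)+
qed

end

type_synonym ('a, 'b) pre_tensor = "('a, 'b) mult_pair \<Rightarrow>\<^sub>0 complex"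

definition pure :: "'a \<Rightarrow> 'b \<Rightarrow> ('a, 'b) pre_tensor" where
  "pure a b = Poly_Mapping.single (Mult_Pair a b) 1"

definition bilinear_relators :: "('a::calgebra, 'b::calgebra) pre_tensor set" where
  "bilinear_relators =
     {pure (a + a') b - pure a b - pure a' b | a a' b. True} \<union>
     {pure a (b + b') - pure a b - pure a b' | a b b'. True} \<union>
     {pure (c *\<^sub>C a) b - c *\<^sub>C pure a b | c a b. True} \<union>
     {pure a (c *\<^sub>C b) - c *\<^sub>C pure a b | c a b. True}"

text \<open>Following the vector space construction, the quotient is by the linear span of the
  bilinearity relators; it is closed under multiplication from both sides.\<close>

lemma pure_mult: "pure a b * pure a' b' = pure (a * a') (b * b')"
  by (simp add: pure_def mult_single)

lemma pre_tensor_induct [case_names zero pure add]: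
  fixes p :: "('a::calgebra, 'b::calgebra) pre_tensor"
  assumes "P 0" "\<And>c a b. P (c *\<^sub>C pure a b)" "\<And>p q. P p \<Longrightarrow> P q \<Longrightarrow> P (p + q)"
  shows "P p"
proof (induction p rule: poly_mapping_induct_add)
  case (single k c)
  show ?case
    using assms(2)[of c] by (cases k) (simp add: pure_def scaleC_single scaleC_complex_def)
qed (use assms in auto)

lemma bilinear_relators_pure_mult:
  assumes "r \<in> bilinear_relators"
  shows "pure a b * r \<in> bilinear_relators" "r * pure a b \<in> bilinear_relators"
proof -
  consider x x' y where "r = pure (x + x') y - pure x y - pure x' y"
    | x y y' where "r = pure x (y + y') - pure x y - pure x y'"
    | c x y where "r = pure (c *\<^sub>C x) y - c *\<^sub>C pure x y"
    | c x y where "r = pure x (c *\<^sub>C y) - c *\<^sub>C pure x y"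
    using assms unfolding bilinear_relators_def by blast
  then have "pure a b * r \<in> bilinear_relators \<and> r * pure a b \<in> bilinear_relators"
  proof cases
    case 1
    then show ?thesis
      unfolding bilinear_relators_def
      by (simp only: left_diff_distrib right_diff_distrib pure_mult distrib_left distrib_right) blast
  next
    case 2
    then show ?thesis
      unfolding bilinear_relators_def
      by (simp only: left_diff_distrib right_diff_distrib pure_mult distrib_left distrib_right) blast
  next
    case 3
    then show ?thesis
      unfolding bilinear_relators_def
      by (simp only: left_diff_distrib right_diff_distrib pure_mult mult_scaleC_left
          mult_scaleC_right) blast
  next
    case 4
    then show ?thesis
      unfolding bilinear_relators_def
      by (simp only: left_diff_distrib right_diff_distrib pure_mult mult_scaleC_left
          mult_scaleC_right) blast
  qed
  then show "pure a b * r \<in> bilinear_relators" "r * pure a b \<in> bilinear_relators"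
    by blast+
qed

lemma bilinear_span_mult:
  assumes "p \<in> calgebra.span bilinear_relators"
  shows "x * p \<in> calgebra.span bilinear_relators" "p * x \<in> calgebra.span bilinear_relators"
proof -
  have pure: "pure a b * p \<in> calgebra.span bilinear_relators \<and>
      p * pure a b \<in> calgebra.span bilinear_relators" for a b
    using assms
    by (induction rule: calgebra.span_induct_alt)
       (auto simp: distrib_left distrib_right mult_scaleC_left mult_scaleC_right calgebra.span_zero
         intro: calgebra.span_add calgebra.span_scale calgebra.span_base bilinear_relators_pure_mult)
  show "x * p \<in> calgebra.span bilinear_relators"
    by (induction x rule: pre_tensor_induct)
       (auto simp: distrib_right mult_scaleC_left pure
         intro: calgebra.span_zero calgebra.span_add calgebra.span_scale)
  show "p * x \<in> calgebra.span bilinear_relators"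
    by (induction x rule: pre_tensor_induct)
       (auto simp: distrib_left mult_scaleC_right pure
         intro: calgebra.span_zero calgebra.span_add calgebra.span_scale)
qed

definition tensor_eq ::
  "('a::calgebra, 'b::calgebra) pre_tensor \<Rightarrow> ('a, 'b) pre_tensor \<Rightarrow> bool" where
  "tensor_eq p q \<longleftrightarrow> p - q \<in> calgebra.span bilinear_relators"

quotient_type (overloaded) ('a, 'b) tensor = "('a::calgebra, 'b::calgebra) pre_tensor" / tensor_eq
proof (rule equivpI)
  show "reflp tensor_eq"
    by (auto simp: reflp_def tensor_eq_def calgebra.span_zero)
  show "symp tensor_eq"
    by (auto simp: symp_def tensor_eq_def dest: calgebra.span_neg)
  show "transp tensor_eq"
    by (auto simp: transp_def tensor_eq_def dest: calgebra.span_add)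
qed

instantiation tensor :: (calgebra, calgebra) calgebra
begin

lift_definition zero_tensor :: "('a, 'b) tensor" is 0 .

lift_definition one_tensor :: "('a, 'b) tensor" is 1 .

lift_definition plus_tensor :: "('a, 'b) tensor \<Rightarrow> ('a, 'b) tensor \<Rightarrow> ('a, 'b) tensor" is "(+)"
  unfolding tensor_eq_def by (drule (1) calgebra.span_add) (simp add: algebra_simps)

lift_definition uminus_tensor :: "('a, 'b) tensor \<Rightarrow> ('a, 'b) tensor" is uminus
  unfolding tensor_eq_def by (drule calgebra.span_neg) simp

lift_definition minus_tensor :: "('a, 'b) tensor \<Rightarrow> ('a, 'b) tensor \<Rightarrow> ('a, 'b) tensor" is "(-)"
  unfolding tensor_eq_def by (drule (1) calgebra.span_diff) (simp add: algebra_simps)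

lift_definition times_tensor :: "('a, 'b) tensor \<Rightarrow> ('a, 'b) tensor \<Rightarrow> ('a, 'b) tensor" is "(*)"
proof -
  fix p p' q q' :: "('a, 'b) pre_tensor"
  assume "tensor_eq p p'" "tensor_eq q q'"
  then have "(p - p') * q + p' * (q - q') \<in> calgebra.span bilinear_relators"
    by (auto simp: tensor_eq_def intro: calgebra.span_add bilinear_span_mult)
  then show "tensor_eq (p * q) (p' * q')"
    by (simp add: tensor_eq_def algebra_simps)
qed

lift_definition scaleC_tensor :: "complex \<Rightarrow> ('a, 'b) tensor \<Rightarrow> ('a, 'b) tensor" is scaleC
  unfolding tensor_eq_def
  by (drule calgebra.span_scale) (simp add: calgebra.scale_right_diff_distrib)

instance
  by standard (transfer; simp add: tensor_eq_def calgebra.span_zero algebra_simps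
    scaleC_add_right scaleC_add_left mult_scaleC_left mult_scaleC_right)+

end

lift_definition tensor_elem :: "'a::calgebra \<Rightarrow> 'b::calgebra \<Rightarrow> ('a, 'b) tensor"
  (infixl \<open>\<otimes>\<close> 72) is pure .

lemma tensor_mult: "(a \<otimes> b) * (a' \<otimes> b') = (a * a') \<otimes> (b * b')"
  by transfer (simp add: pure_mult tensor_eq_def calgebra.span_zero)

lemma tensor_one: "1 \<otimes> 1 = 1"
  by transfer (simp add: pure_def tensor_eq_def calgebra.span_zero
      flip: zero_mult_pair_def single_one)

lemma tensor_add_left: "(a + a') \<otimes> b = a \<otimes> b + a' \<otimes> b"
  by transfer
     (unfold tensor_eq_def diff_diff_eq[symmetric], rule calgebra.span_base,
      unfold bilinear_relators_def, blast)

lemma tensor_add_right: "a \<otimes> (b + b') = a \<otimes> b + a \<otimes> b'"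
  by transfer
     (unfold tensor_eq_def diff_diff_eq[symmetric], rule calgebra.span_base,
      unfold bilinear_relators_def, blast)

lemma tensor_scaleC_left: "(c *\<^sub>C a) \<otimes> b = c *\<^sub>C (a \<otimes> b)"
  by transfer
     (unfold tensor_eq_def, rule calgebra.span_base, unfold bilinear_relators_def, blast)

lemma tensor_scaleC_right: "a \<otimes> (c *\<^sub>C b) = c *\<^sub>C (a \<otimes> b)"
  by transfer
     (unfold tensor_eq_def, rule calgebra.span_base, unfold bilinear_relators_def, blast)

lemma tensor_zero_left [simp]: "0 \<otimes> b = 0"
  using tensor_add_left[of 0 0 b] by simp

lemma tensor_zero_right [simp]: "a \<otimes> 0 = 0"
  using tensor_add_right[of a 0 0] by simp

lemma tensor_diff_left: "(a - a') \<otimes> b = a \<otimes> b - a' \<otimes> b"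
  using tensor_add_left[of "a - a'" a' b] by (simp add: algebra_simps)

lemma tensor_diff_right: "a \<otimes> (b - b') = a \<otimes> b - a \<otimes> b'"
  using tensor_add_right[of a "b - b'" b'] by (simp add: algebra_simps)


section \<open>The universal enveloping algebra of \<open>sl\<^sub>2\<close>\<close>

datatype sl2_gen = Gen_E | Gen_F | Gen_H

instantiation sl2_gen :: presentation
begin

definition relators_sl2_gen :: "sl2_gen free_algebra set" where
  "relators_sl2_gen =
     (let e = free_gen Gen_E; f = free_gen Gen_F; h = free_gen Gen_H in
       {commutator h e - 2 *\<^sub>C e,
        commutator h f - (- 2) *\<^sub>C f,
        commutator e f - h})"

instance ..

end

type_synonym U_sl2 = "sl2_gen presented"

definition U_E :: U_sl2 where "U_E = gen Gen_E"
definition U_F :: U_sl2 where "U_F = gen Gen_F"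
definition U_H :: U_sl2 where "U_H = gen Gen_H"

definition casimir :: U_sl2 where
  "casimir = U_E * U_F + U_F * U_E + (1 / 2) *\<^sub>C U_H ^ 2"

lemma U_sl2_relations:
  "commutator U_H U_E = 2 *\<^sub>C U_E"
  "commutator U_H U_F = (- 2) *\<^sub>C U_F"
  "commutator U_E U_F = U_H"
  unfolding U_E_def U_F_def U_H_def commutator_def
  by (transfer, unfold presented_eq_def relators_sl2_gen_def Let_def commutator_def,
      rule two_sided_ideal.base, blast)+

definition comult_gen :: "sl2_gen \<Rightarrow> (U_sl2, U_sl2) tensor" where
  "comult_gen x = gen x \<otimes> 1 + 1 \<otimes> gen x"

lemma comult_gen_commutator:
  "commutator (comult_gen x) (comult_gen y) =
     commutator (gen x) (gen y) \<otimes> 1 + 1 \<otimes> commutator (gen x) (gen y)"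
  by (simp add: comult_gen_def commutator_def distrib_left distrib_right tensor_mult
      tensor_diff_left tensor_diff_right)

lemma free_lift_comult_gen_relators:
  assumes "r \<in> relators"
  shows "free_lift comult_gen r = 0"
proof -
  have comm: "free_lift comult_gen (commutator p q) =
      commutator (free_lift comult_gen p) (free_lift comult_gen q)" for p q
    using alg_hom_free_lift[of comult_gen] alg_hom_diff[OF alg_hom_free_lift[of comult_gen]]
    by (simp add: commutator_def alg_hom_def)
  have scale: "free_lift comult_gen (c *\<^sub>C p) = c *\<^sub>C free_lift comult_gen p" for c p
    using alg_hom_free_lift[of comult_gen] by (simp add: alg_hom_def)
  have rels: "commutator (comult_gen Gen_H) (comult_gen Gen_E) = 2 *\<^sub>C comult_gen Gen_E"
    "commutator (comult_gen Gen_H) (comult_gen Gen_F) = (- 2) *\<^sub>C comult_gen Gen_F"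
    "commutator (comult_gen Gen_E) (comult_gen Gen_F) = comult_gen Gen_H"
    unfolding comult_gen_commutator U_sl2_relations[unfolded U_E_def U_F_def U_H_def]
    by (simp_all only: comult_gen_def scaleC_add_right tensor_scaleC_left tensor_scaleC_right)
  from assms consider
      "r = commutator (free_gen Gen_H) (free_gen Gen_E) - 2 *\<^sub>C free_gen Gen_E"
    | "r = commutator (free_gen Gen_H) (free_gen Gen_F) - (- 2) *\<^sub>C free_gen Gen_F"
    | "r = commutator (free_gen Gen_E) (free_gen Gen_F) - free_gen Gen_H"
    unfolding relators_sl2_gen_def Let_def by blast
  then show ?thesis
    by cases (simp_all only: comm scale rels alg_hom_diff[OF alg_hom_free_lift] free_lift_gen diff_self)
qed

lift_definition comult :: "U_sl2 \<Rightarrow> (U_sl2, U_sl2) tensor" is "free_lift comult_gen"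
proof -
  fix p q :: "sl2_gen free_algebra"
  assume "presented_eq p q"
  then have "free_lift comult_gen (p - q) = 0"
    unfolding presented_eq_def
    using alg_hom_eq_zero_on_ideal[OF alg_hom_free_lift free_lift_comult_gen_relators] by blast
  then show "free_lift comult_gen p = free_lift comult_gen q"
    by (simp add: alg_hom_diff[OF alg_hom_free_lift])
qed

lemma alg_hom_comult: "alg_hom comult"
proof -
  note lift = alg_hom_free_lift[of comult_gen, unfolded alg_hom_def]
  have "comult 1 = 1"
    using lift by (simp add: one_presented_def comult.abs_eq)
  moreover have "comult (x + y) = comult x + comult y" for x y
    using lift by (induct x; induct y) (simp add: plus_presented.abs_eq comult.abs_eq)
  moreover have "comult (x * y) = comult x * comult y" for x y
    using lift by (induct x; induct y) (simp add: times_presented.abs_eq comult.abs_eq)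
  moreover have "comult (c *\<^sub>C x) = c *\<^sub>C comult x" for c x
    using lift by (induct x) (simp add: scaleC_presented.abs_eq comult.abs_eq)
  ultimately show ?thesis
    by (simp add: alg_hom_def)
qed

lemma comult_U_gens:
  "comult U_E = U_E \<otimes> 1 + 1 \<otimes> U_E"
  "comult U_F = U_F \<otimes> 1 + 1 \<otimes> U_F"
  "comult U_H = U_H \<otimes> 1 + 1 \<otimes> U_H"
proof -
  have "comult (gen x) = comult_gen x" for x
    by (simp add: comult.abs_eq flip: abs_presented_free_gen)
  then show "comult U_E = U_E \<otimes> 1 + 1 \<otimes> U_E"
    "comult U_F = U_F \<otimes> 1 + 1 \<otimes> U_F"
    "comult U_H = U_H \<otimes> 1 + 1 \<otimes> U_H"
    by (simp_all add: U_E_def U_F_def U_H_def comult_gen_def)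
qed

lemma comult_unique:
  assumes "alg_hom f" "\<And>X. X \<in> {U_E, U_F, U_H} \<Longrightarrow> f X = X \<otimes> 1 + 1 \<otimes> X"
  shows "f = comult"
proof (rule alg_hom_presented_ext[OF assms(1) alg_hom_comult])
  fix x :: sl2_gen
  show "f (gen x) = comult (gen x)"
    using assms(2) comult_U_gens by (cases x) (auto simp: U_E_def U_F_def U_H_def)
qed


section \<open>The universal Hahn algebra\<close>

definition hahn_alpha :: "'a::calgebra \<Rightarrow> 'a \<Rightarrow> 'a \<Rightarrow> 'a" where
  "hahn_alpha a b c = commutator c a + 2 *\<^sub>C a ^ 2 + b"

definition hahn_beta :: "'a::calgebra \<Rightarrow> 'a \<Rightarrow> 'a \<Rightarrow> 'a" where
  "hahn_beta a b c = commutator b c + 4 *\<^sub>C (b * a) + 2 *\<^sub>C c"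

datatype hahn_gen = Gen_A | Gen_B | Gen_C

instantiation hahn_gen :: presentation
begin

definition relators_hahn_gen :: "hahn_gen free_algebra set" where
  "relators_hahn_gen =
     (let a = free_gen Gen_A; b = free_gen Gen_B; c = free_gen Gen_C in
       {commutator a b - c} \<union>
       {commutator (hahn_alpha a b c) x | x. True} \<union>
       {commutator (hahn_beta a b c) x | x. True})"

instance ..

end

type_synonym hahn = "hahn_gen presented"

definition hahn_A :: hahn where "hahn_A = gen Gen_A"
definition hahn_B :: hahn where "hahn_B = gen Gen_B"
definition hahn_C :: hahn where "hahn_C = gen Gen_C"

lemma hahn_relations:
  "commutator hahn_A hahn_B = hahn_C"
  "commutator (hahn_alpha hahn_A hahn_B hahn_C) x = 0"
  "commutator (hahn_beta hahn_A hahn_B hahn_C) x = 0"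
proof -
  let ?a = "free_gen Gen_A" and ?b = "free_gen Gen_B" and ?c = "free_gen Gen_C"
  have zero: "abs_presented r = 0" if "r \<in> relators" for r :: "hahn_gen free_algebra"
    using that by (simp add: zero_presented_def presented.abs_eq_iff presented_eq_def
        two_sided_ideal.base)
  note hom = alg_hom_abs_presented[unfolded alg_hom_def] alg_hom_diff[OF alg_hom_abs_presented]
  note defs = hahn_A_def hahn_B_def hahn_C_def hahn_alpha_def hahn_beta_def commutator_def
    power2_eq_square
  have "abs_presented (commutator ?a ?b - ?c) = 0"
    by (rule zero) (simp add: relators_hahn_gen_def Let_def)
  then show "commutator hahn_A hahn_B = hahn_C"
    by (simp add: defs hom)
  have "abs_presented (commutator (hahn_alpha ?a ?b ?c) p) = 0" for p
    by (rule zero) (auto simp: relators_hahn_gen_def Let_def)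
  then show "commutator (hahn_alpha hahn_A hahn_B hahn_C) x = 0"
    by (induct x) (simp add: defs hom)
  have "abs_presented (commutator (hahn_beta ?a ?b ?c) p) = 0" for p
    by (rule zero) (auto simp: relators_hahn_gen_def Let_def)
  then show "commutator (hahn_beta hahn_A hahn_B hahn_C) x = 0"
    by (induct x) (simp add: defs hom)
qed

definition natural_hom :: "(hahn \<Rightarrow> (U_sl2, U_sl2) tensor) \<Rightarrow> bool" where
  "natural_hom \<phi> \<longleftrightarrow>
     alg_hom \<phi> \<and>
     \<phi> hahn_A = (1 / 4) *\<^sub>C (U_H \<otimes> 1 - 1 \<otimes> U_H) \<and>
     \<phi> hahn_B = (1 / 2) *\<^sub>C comult casimir \<and>
     \<phi> hahn_C = U_E \<otimes> U_F - U_F \<otimes> U_E"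

end

theory Submission
  imports Defs
begin

text \<open>Write \<open>X\<^sub>1 = X \<otimes> 1\<close> and \<open>X\<^sub>2 = 1 \<otimes> X\<close>: these are two commuting \<open>sl\<^sub>2\<close>-triples. From
  \<open>\<Delta>(\<Lambda>) = \<Lambda>\<^sub>1 + \<Lambda>\<^sub>2 + 2 (E\<^sub>1 F\<^sub>2 + F\<^sub>1 E\<^sub>2) + H\<^sub>1 H\<^sub>2\<close> one reads off that the images \<open>a, b, c\<close> of the
  generators satisfy \<open>[a, b] = c\<close>, and normal ordering gives the stated values of \<open>\<alpha>\<close> and \<open>\<beta>\<close>. These
  values are polynomials in \<open>\<Lambda>\<^sub>1\<close>, \<open>\<Lambda>\<^sub>2\<close>, which are central, and \<open>\<Delta>(H)\<close>, which commutes with \<open>a\<close> and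
  \<open>c\<close> as these have weight zero, and with \<open>b = \<Delta>(\<Lambda>)/2\<close> as \<open>\<Lambda>\<close> is central. So all defining
  relations of the Hahn algebra hold in the image.\<close>

section \<open>Homomorphisms out of presented algebras\<close>

lemma alg_hom_commutator:
  "alg_hom f \<Longrightarrow> f (commutator x y) = commutator (f x) (f y)"
  by (simp add: commutator_def alg_hom_diff) (simp add: alg_hom_def)

lemma alg_hom_power: "alg_hom f \<Longrightarrow> f (x ^ n) = f x ^ n"
  by (induction n) (simp_all add: alg_hom_def)

lemma alg_hom_hahn_alpha:
  "alg_hom f \<Longrightarrow> f (hahn_alpha a b c) = hahn_alpha (f a) (f b) (f c)"
  using alg_hom_commutator[of f] alg_hom_power[of f]
  by (simp add: hahn_alpha_def alg_hom_def)

lemma alg_hom_hahn_beta: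
  "alg_hom f \<Longrightarrow> f (hahn_beta a b c) = hahn_beta (f a) (f b) (f c)"
  using alg_hom_commutator[of f]
  by (simp add: hahn_beta_def alg_hom_def)

text \<open>The universal property of the quotient: \<open>free_lift g\<close> vanishes on the ideal
  generated by the relators, so its value does not depend on the representative chosen by
  \<open>rep_presented\<close>.\<close>

lemma presented_lift_exists:
  fixes g :: "'x::presentation \<Rightarrow> 'a::calgebra"
  assumes "\<And>r. r \<in> relators \<Longrightarrow> free_lift g r = 0"
  obtains f where "alg_hom f" "\<And>x. f (gen x) = g x"
proof -
  define f where "f x = free_lift g (rep_presented x)" for x
  have abs: "f (abs_presented p) = free_lift g p" for p
  proof -
    have "presented_eq (rep_presented (abs_presented p)) p"
      by (metis Quotient_presented Quotient_rep_abs presented.abs_eq_iff)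
    then have "free_lift g (rep_presented (abs_presented p) - p) = 0"
      unfolding presented_eq_def
      using alg_hom_eq_zero_on_ideal[OF alg_hom_free_lift assms] by blast
    then show ?thesis
      by (simp add: f_def alg_hom_diff[OF alg_hom_free_lift])
  qed
  note lift = alg_hom_free_lift[of g, unfolded alg_hom_def]
  have "f 1 = 1"
    using lift by (simp add: one_presented_def abs)
  moreover have "f (x + y) = f x + f y" for x y
    using lift by (induct x; induct y) (simp add: plus_presented.abs_eq abs)
  moreover have "f (x * y) = f x * f y" for x y
    using lift by (induct x; induct y) (simp add: times_presented.abs_eq abs)
  moreover have "f (c *\<^sub>C x) = c *\<^sub>C f x" for c x
    using lift by (induct x) (simp add: scaleC_presented.abs_eq abs)
  ultimately have "alg_hom f"
    by (simp add: alg_hom_def)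
  moreover have "f (gen x) = g x" for x
    by (simp add: abs flip: abs_presented_free_gen)
  ultimately show ?thesis ..
qed

section \<open>Commuting elements\<close>

lemma commutes_add:
  fixes x :: "'a::calgebra"
  shows "x * y = y * x \<Longrightarrow> x * z = z * x \<Longrightarrow> x * (y + z) = (y + z) * x"
  by (simp add: algebra_simps)

lemma commutes_diff:
  fixes x :: "'a::calgebra"
  shows "x * y = y * x \<Longrightarrow> x * z = z * x \<Longrightarrow> x * (y - z) = (y - z) * x"
  by (simp add: algebra_simps)

lemma commutes_mult:
  fixes x :: "'a::calgebra"
  shows "x * y = y * x \<Longrightarrow> x * z = z * x \<Longrightarrow> x * (y * z) = (y * z) * x"
  by (metis mult.assoc)

lemma commutes_scaleC:
  fixes x :: "'a::calgebra"
  shows "x * y = y * x \<Longrightarrow> x * (c *\<^sub>C y) = (c *\<^sub>C y) * x"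
  by (simp add: mult_scaleC_left mult_scaleC_right)

lemmas commutes_intros = commutes_add commutes_diff commutes_mult commutes_scaleC

text \<open>The centralizer of \<open>z\<close> is a subalgebra, and \<open>free_lift g p\<close>
  lies in the subalgebra generated by the \<open>g x\<close>.\<close>

lemma commutes_free_lift:
  assumes "\<And>x. z * g x = g x * z"
  shows "z * free_lift g p = free_lift g p * z"
proof -
  have word: "z * prod_list (map g xs) = prod_list (map g xs) * z" for xs
    using assms by (induction xs) (simp, simp add: commutes_mult)
  show ?thesis
    by (induction p rule: poly_mapping_induct_add)
       (simp_all add: free_lift_def lin_ext_add commutes_add commutes_scaleC word)
qed

text \<open>The relators express centrality against every element of the free algebra. By
  \<open>commutes_free_lift\<close> it suffices to test the three generators.\<close>

lemma hahn_lift_exists: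
  fixes a b c :: "'a::calgebra"
  assumes ab: "commutator a b = c"
    and alpha: "\<And>x. x \<in> {a, b, c} \<Longrightarrow> hahn_alpha a b c * x = x * hahn_alpha a b c"
    and beta: "\<And>x. x \<in> {a, b, c} \<Longrightarrow> hahn_beta a b c * x = x * hahn_beta a b c"
  obtains f where "alg_hom f" "f hahn_A = a" "f hahn_B = b" "f hahn_C = c"
proof -
  define g where "g x = (case x of Gen_A \<Rightarrow> a | Gen_B \<Rightarrow> b | Gen_C \<Rightarrow> c)" for x
  have g: "g Gen_A = a" "g Gen_B = b" "g Gen_C = c"
    by (simp_all add: g_def)
  have mem: "g x \<in> {a, b, c}" for x
    by (cases x) (simp_all add: g)
  have "free_lift g r = 0" if "r \<in> relators" for r
  proof -
    note hom = alg_hom_free_lift[of g]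
    from that consider "r = commutator (free_gen Gen_A) (free_gen Gen_B) - free_gen Gen_C"
      | x where "r = commutator (hahn_alpha (free_gen Gen_A) (free_gen Gen_B) (free_gen Gen_C)) x"
      | x where "r = commutator (hahn_beta (free_gen Gen_A) (free_gen Gen_B) (free_gen Gen_C)) x"
      unfolding relators_hahn_gen_def Let_def by blast
    then show ?thesis
    proof cases
      case 1
      then show ?thesis
        by (simp add: alg_hom_diff[OF hom] alg_hom_commutator[OF hom] g ab)
    next
      case 2
      then show ?thesis
        using commutes_free_lift[of "hahn_alpha a b c" g, OF alpha[OF mem]]
        by (simp add: alg_hom_commutator[OF hom] alg_hom_hahn_alpha[OF hom] g)
           (simp add: commutator_def)
    next
      case 3
      then show ?thesis
        using commutes_free_lift[of "hahn_beta a b c" g, OF beta[OF mem]]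
        by (simp add: alg_hom_commutator[OF hom] alg_hom_hahn_beta[OF hom] g)
           (simp add: commutator_def)
    qed
  qed
  then obtain f where "alg_hom f" "\<And>x. f (gen x) = g x"
    using presented_lift_exists[of g] by metis
  then show ?thesis
    using that g by (simp add: hahn_A_def hahn_B_def hahn_C_def)
qed

section \<open>Commuting \<open>sl\<^sub>2\<close>-triples\<close>

text \<open>Integer multiples are unfolded into sums so that ordered monomials cancel
  termwise.\<close>

lemma scaleC_2: "2 *\<^sub>C (x :: 'a::calgebra) = x + x"
  by (metis one_add_one scaleC_add_left scaleC_one)

lemma scaleC_4: "4 *\<^sub>C (x :: 'a::calgebra) = x + x + (x + x)"
  by (metis numeral_Bit0 scaleC_add_left scaleC_2)

text \<open>Kept abstract because it is used for three triples: the two tensor factors and their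
  sum.\<close>

locale sl2_triple =
  fixes e f h :: "'a::calgebra"
  assumes he: "commutator h e = 2 *\<^sub>C e"
    and hf: "commutator h f = (- 2) *\<^sub>C f"
    and ef: "commutator e f = h"
begin

definition cas :: 'a where
  "cas = e * f + f * e + (1 / 2) *\<^sub>C h ^ 2"

lemma h_e: "h * e = e * h + e + e"
  using he by (simp add: commutator_def scaleC_2 algebra_simps)

lemma h_f: "h * f = f * h - f - f"
  using hf by (simp add: commutator_def scaleC_2 algebra_simps)

lemma e_f: "e * f = f * e + h"
  using ef by (simp add: commutator_def algebra_simps)

text \<open>Normal ordering puts \<open>f\<close> before \<open>e\<close> before \<open>h\<close>.
  These variants apply inside right-nested products, where the two letters to be exchanged are
  followed by a further factor.\<close>

lemma left_rules:
  "h * (e * x) = e * (h * x) + e * x + e * x"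
  "h * (f * x) = f * (h * x) - f * x - f * x"
  "e * (f * x) = f * (e * x) + h * x"
  by (simp_all add: h_e h_f e_f distrib_right left_diff_distrib flip: mult.assoc)

lemmas normal_order = h_e h_f e_f left_rules

lemma two_cas: "2 *\<^sub>C cas = e * f + e * f + f * e + f * e + h * h"
  by (simp add: cas_def scaleC_add_right power2_eq_square) (simp add: scaleC_2 algebra_simps)

lemma cas_commutes: "cas * e = e * cas" "cas * f = f * cas" "cas * h = h * cas"
proof -
  \<comment> \<open>Doubling removes the coefficient 1/2, so normal ordering decides the claim; the
    factor 2 is cancelled afterwards.\<close>
  have "(2 *\<^sub>C cas) * e = e * (2 *\<^sub>C cas)" "(2 *\<^sub>C cas) * f = f * (2 *\<^sub>C cas)"
    "(2 *\<^sub>C cas) * h = h * (2 *\<^sub>C cas)"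
    unfolding two_cas by (simp_all add: algebra_simps normal_order)
  then show "cas * e = e * cas" "cas * f = f * cas" "cas * h = h * cas"
    by (simp_all add: mult_scaleC_left mult_scaleC_right)
qed

end

locale commuting_sl2_triples =
  s1: sl2_triple e1 f1 h1 + s2: sl2_triple e2 f2 h2
  for e1 f1 h1 e2 f2 h2 :: "'a::calgebra" +
  assumes commute: "x \<in> {e1, f1, h1} \<Longrightarrow> y \<in> {e2, f2, h2} \<Longrightarrow> y * x = x * y"
begin

lemma swap:
  "e2 * e1 = e1 * e2" "e2 * f1 = f1 * e2" "e2 * h1 = h1 * e2"
  "f2 * e1 = e1 * f2" "f2 * f1 = f1 * f2" "f2 * h1 = h1 * f2"
  "h2 * e1 = e1 * h2" "h2 * f1 = f1 * h2" "h2 * h1 = h1 * h2"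
  using commute by blast+

lemma swap_left:
  "e2 * (e1 * x) = e1 * (e2 * x)" "e2 * (f1 * x) = f1 * (e2 * x)" "e2 * (h1 * x) = h1 * (e2 * x)"
  "f2 * (e1 * x) = e1 * (f2 * x)" "f2 * (f1 * x) = f1 * (f2 * x)" "f2 * (h1 * x) = h1 * (f2 * x)"
  "h2 * (e1 * x) = e1 * (h2 * x)" "h2 * (f1 * x) = f1 * (h2 * x)" "h2 * (h1 * x) = h1 * (h2 * x)"
  by (simp_all add: swap flip: mult.assoc)

lemmas normal_order = swap swap_left s1.normal_order s2.normal_order

text \<open>Cross commutators vanish, so brackets add up. This is the abstract form of the
  comultiplication.\<close>

sublocale sum: sl2_triple "e1 + e2" "f1 + f2" "h1 + h2"
  by unfold_locales
     (simp_all add: commutator_def normal_order algebra_simps scaleC_2)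

section \<open>Hahn elements of a commuting pair of triples\<close>

definition A :: 'a where "A = (1 / 4) *\<^sub>C (h1 - h2)"
definition B :: 'a where "B = (1 / 2) *\<^sub>C sum.cas"
definition C :: 'a where "C = e1 * f2 - f1 * e2"

lemma four_A: "4 *\<^sub>C A = h1 - h2"
  by (simp add: A_def)

lemma four_B: "4 *\<^sub>C B = 2 *\<^sub>C sum.cas"
  by (simp add: B_def)

lemma commutator_A_B: "commutator A B = C"
proof -
  \<comment> \<open>Clearing denominators leaves integer coefficients, so that both sides become plain sums of
    ordered monomials and cancel termwise.\<close>
  have "4 *\<^sub>C 4 *\<^sub>C commutator A B = commutator (4 *\<^sub>C A) (4 *\<^sub>C B)"
    by (simp add: commutator_def mult_scaleC_left mult_scaleC_right calgebra.scale_right_diff_distrib)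
  also have "\<dots> = 4 *\<^sub>C 4 *\<^sub>C C"
    unfolding four_A four_B unfolding sum.two_cas C_def commutator_def scaleC_4
    by (simp add: algebra_simps normal_order)
  finally show ?thesis by simp
qed

text \<open>\<open>[C, A] = - (e1 * f2 + f1 * e2)\<close> cancels the mixed terms of
  \<open>B\<close>, and the \<open>h1 * h2 / 2\<close> in \<open>B\<close> completes
  \<open>2 A^2 = (h1 - h2)^2 / 8\<close> to \<open>(h1 + h2)^2 / 8\<close>.\<close>

lemma hahn_alpha_eq:
  "hahn_alpha A B C = (1 / 2) *\<^sub>C (s1.cas + s2.cas) + (1 / 8) *\<^sub>C (h1 + h2) ^ 2"
proof -
  \<comment> \<open>The factor 8 makes every term an integer combination of products of
    \<open>4 A\<close>, \<open>4 B\<close> and \<open>C\<close>, since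
    \<open>8 * 2 A^2 = (4 A)^2\<close>.\<close>
  have "8 *\<^sub>C hahn_alpha A B C =
      2 *\<^sub>C commutator C (4 *\<^sub>C A) + (4 *\<^sub>C A) * (4 *\<^sub>C A) + 2 *\<^sub>C 4 *\<^sub>C B"
    by (simp add: hahn_alpha_def commutator_def power2_eq_square scaleC_add_right
        mult_scaleC_left mult_scaleC_right calgebra.scale_right_diff_distrib)
  also have "\<dots> = 2 *\<^sub>C 2 *\<^sub>C s1.cas + 2 *\<^sub>C 2 *\<^sub>C s2.cas + (h1 + h2) * (h1 + h2)"
    unfolding four_A four_B sum.two_cas s1.two_cas s2.two_cas C_def commutator_def
    by (simp add: scaleC_2 algebra_simps normal_order)
  also have "\<dots> =
      8 *\<^sub>C ((1 / 2) *\<^sub>C (s1.cas + s2.cas) + (1 / 8) *\<^sub>C (h1 + h2) ^ 2)"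
    by (simp add: scaleC_add_right power2_eq_square)
  finally show ?thesis by simp
qed

text \<open>Put \<open>M = e1 * f2 + f1 * e2\<close>. The term \<open>h1 * h2 / 2\<close> of
  \<open>B\<close> contributes \<open>- M (h1 - h2) - 2 C\<close> to \<open>[B, C]\<close>, which
  cancels \<open>2 C\<close> and the \<open>M\<close> part of \<open>4 B A\<close>. What remains is
  \<open>[M, C]\<close> and the rest of \<open>4 B A\<close>, which combine to the stated
  value.\<close>

lemma hahn_beta_eq:
  "hahn_beta A B C = (1 / 2) *\<^sub>C ((s1.cas - s2.cas) * (h1 + h2))"
proof -
  have "4 *\<^sub>C hahn_beta A B C =
      commutator (4 *\<^sub>C B) C + (4 *\<^sub>C B) * (4 *\<^sub>C A) + 2 *\<^sub>C 4 *\<^sub>C C"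
    by (simp add: hahn_beta_def commutator_def scaleC_add_right
        mult_scaleC_left mult_scaleC_right calgebra.scale_right_diff_distrib)
  also have "\<dots> = (2 *\<^sub>C s1.cas - 2 *\<^sub>C s2.cas) * (h1 + h2)"
    unfolding four_A four_B sum.two_cas s1.two_cas s2.two_cas C_def commutator_def
    by (simp add: scaleC_2 scaleC_4 algebra_simps normal_order)
  also have "\<dots> = 4 *\<^sub>C ((1 / 2) *\<^sub>C ((s1.cas - s2.cas) * (h1 + h2)))"
    by (simp add: mult_scaleC_left flip: calgebra.scale_right_diff_distrib)
  finally show ?thesis
    by (subst (asm) calgebra.scale_cancel_left) simp
qed

text \<open>Each Casimir is central for its own triple and is a polynomial in letters that commute
  with the other triple.\<close>

lemma cas_commutes_all:
  assumes "x \<in> {e1, f1, h1, e2, f2, h2}"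
  shows "x * s1.cas = s1.cas * x" "x * s2.cas = s2.cas * x"
proof -
  have "x * s1.cas = s1.cas * x" if "x \<in> {e2, f2, h2}"
    using that commute[OF _ that] unfolding s1.cas_def power2_eq_square
    by (intro commutes_intros) auto
  moreover have "x * s2.cas = s2.cas * x" if "x \<in> {e1, f1, h1}"
    using that commute[OF that] unfolding s2.cas_def power2_eq_square
    by (intro commutes_intros) auto
  ultimately show "x * s1.cas = s1.cas * x" "x * s2.cas = s2.cas * x"
    using assms s1.cas_commutes s2.cas_commutes by auto
qed

lemma cas_commutes_A_B_C:
  assumes "z = s1.cas \<or> z = s2.cas" "x \<in> {A, B, C}"
  shows "z * x = x * z"
proof -
  have gens: "z * y = y * z" if "y \<in> {e1, f1, h1, e2, f2, h2}" for y
    using assms(1) cas_commutes_all[OF that] by auto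
  have "z * A = A * z"
    unfolding A_def by (intro commutes_intros gens) simp_all
  moreover have "z * B = B * z"
    unfolding B_def sum.cas_def power2_eq_square by (intro commutes_intros gens) simp_all
  moreover have "z * C = C * z"
    unfolding C_def by (intro commutes_intros gens) simp_all
  ultimately show ?thesis
    using assms(2) by auto
qed

lemma weight_commutes_A_B_C:
  assumes "x \<in> {A, B, C}"
  shows "(h1 + h2) * x = x * (h1 + h2)"
proof -
  have "(h1 + h2) * A = A * (h1 + h2)"
    unfolding A_def by (intro commutes_scaleC) (simp add: algebra_simps normal_order)
  moreover have "(h1 + h2) * B = B * (h1 + h2)"
    unfolding B_def by (intro commutes_scaleC) (simp add: sum.cas_commutes)
  moreover have "(h1 + h2) * C = C * (h1 + h2)"
    unfolding C_def by (simp add: algebra_simps normal_order)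
  ultimately show ?thesis
    using assms by auto
qed

lemma hahn_alpha_commutes:
  assumes "x \<in> {A, B, C}"
  shows "hahn_alpha A B C * x = x * hahn_alpha A B C"
proof -
  have "x * (h1 + h2) = (h1 + h2) * x" "x * s1.cas = s1.cas * x" "x * s2.cas = s2.cas * x"
    using cas_commutes_A_B_C[OF _ assms] weight_commutes_A_B_C[OF assms] by simp_all
  then show ?thesis
    unfolding hahn_alpha_eq power2_eq_square
    by (intro sym[OF commutes_add] commutes_scaleC commutes_mult commutes_add[of _ "s1.cas" "s2.cas"])
qed

lemma hahn_beta_commutes:
  assumes "x \<in> {A, B, C}"
  shows "hahn_beta A B C * x = x * hahn_beta A B C"
proof -
  have "x * (h1 + h2) = (h1 + h2) * x" "x * s1.cas = s1.cas * x" "x * s2.cas = s2.cas * x"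
    using cas_commutes_A_B_C[OF _ assms] weight_commutes_A_B_C[OF assms] by simp_all
  then show ?thesis
    unfolding hahn_beta_eq
    by (intro sym[OF commutes_scaleC] commutes_mult commutes_diff)
qed

end

section \<open>The two copies of sl2 in the tensor square\<close>

interpretation UU: commuting_sl2_triples
  "U_E \<otimes> 1" "U_F \<otimes> 1" "U_H \<otimes> 1" "1 \<otimes> U_E" "1 \<otimes> U_F" "1 \<otimes> U_H"
proof unfold_locales
  show "commutator (U_H \<otimes> 1) (U_E \<otimes> 1) = 2 *\<^sub>C (U_E \<otimes> 1)"
    "commutator (U_H \<otimes> 1) (U_F \<otimes> 1) = (- 2) *\<^sub>C (U_F \<otimes> 1)"
    "commutator (U_E \<otimes> 1) (U_F \<otimes> 1) = U_H \<otimes> 1"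
    "commutator (1 \<otimes> U_H) (1 \<otimes> U_E) = 2 *\<^sub>C (1 \<otimes> U_E)"
    "commutator (1 \<otimes> U_H) (1 \<otimes> U_F) = (- 2) *\<^sub>C (1 \<otimes> U_F)"
    "commutator (1 \<otimes> U_E) (1 \<otimes> U_F) = 1 \<otimes> U_H"
    using U_sl2_relations unfolding commutator_def
    by (simp_all only: tensor_mult mult_1_left tensor_scaleC_left tensor_scaleC_right
        flip: tensor_diff_left tensor_diff_right)
qed (auto simp: tensor_mult)

text \<open>\<open>comult\<close> is a homomorphism sending the generators to the sum triple, so it
  sends \<open>casimir\<close> to the Casimir of that triple.\<close>

lemma casimir_tensor:
  "UU.s1.cas = casimir \<otimes> 1" "UU.s2.cas = 1 \<otimes> casimir" "UU.sum.cas = comult casimir"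
proof -
  show "UU.s1.cas = casimir \<otimes> 1" "UU.s2.cas = 1 \<otimes> casimir"
    by (simp_all add: UU.s1.cas_def UU.s2.cas_def casimir_def power2_eq_square tensor_mult
        tensor_add_left tensor_add_right tensor_scaleC_left tensor_scaleC_right)
  show "UU.sum.cas = comult casimir"
    using alg_hom_comult unfolding UU.sum.cas_def casimir_def power2_eq_square
    by (simp add: alg_hom_def comult_U_gens)
qed

lemma natural_hom_iff:
  "natural_hom \<phi> \<longleftrightarrow>
     alg_hom \<phi> \<and> \<phi> hahn_A = UU.A \<and> \<phi> hahn_B = UU.B \<and> \<phi> hahn_C = UU.C"
  by (simp add: natural_hom_def UU.A_def UU.B_def UU.C_def casimir_tensor tensor_mult)

theorem theorem1p5:
  "(\<exists>!\<phi>. natural_hom \<phi>) \<and>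
   (\<forall>\<phi>. natural_hom \<phi> \<longrightarrow>
      \<phi> (hahn_alpha hahn_A hahn_B hahn_C) =
        (1 / 2) *\<^sub>C (casimir \<otimes> 1 + 1 \<otimes> casimir) + (1 / 8) *\<^sub>C (comult U_H) ^ 2 \<and>
      \<phi> (hahn_beta hahn_A hahn_B hahn_C) =
        (1 / 2) *\<^sub>C ((casimir \<otimes> 1 - 1 \<otimes> casimir) * comult U_H))"
proof (intro conjI allI impI ex_ex1I)
  show "\<exists>\<phi>. natural_hom \<phi>"
    using hahn_lift_exists[OF UU.commutator_A_B UU.hahn_alpha_commutes UU.hahn_beta_commutes]
    unfolding natural_hom_iff by metis
next
  fix \<phi> \<psi>
  assume "natural_hom \<phi>" "natural_hom \<psi>"
  then have hom: "alg_hom \<phi>" "alg_hom \<psi>"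
    and eq: "\<phi> hahn_A = \<psi> hahn_A" "\<phi> hahn_B = \<psi> hahn_B" "\<phi> hahn_C = \<psi> hahn_C"
    by (simp_all add: natural_hom_iff)
  have "\<phi> (gen x) = \<psi> (gen x)" for x
    using eq by (cases x) (simp_all add: hahn_A_def hahn_B_def hahn_C_def)
  then show "\<phi> = \<psi>"
    using alg_hom_presented_ext[OF hom] by blast
next
  fix \<phi>
  assume "natural_hom \<phi>"
  then have hom: "alg_hom \<phi>"
    and eq: "\<phi> hahn_A = UU.A" "\<phi> hahn_B = UU.B" "\<phi> hahn_C = UU.C"
    by (simp_all add: natural_hom_iff)
  \<comment> \<open>A homomorphism preserves the expressions \<open>hahn_alpha\<close> and
    \<open>hahn_beta\<close>, so both values are those computed for the images \<open>UU.A\<close>,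
    \<open>UU.B\<close>, \<open>UU.C\<close>.\<close>
  show "\<phi> (hahn_alpha hahn_A hahn_B hahn_C) =
      (1 / 2) *\<^sub>C (casimir \<otimes> 1 + 1 \<otimes> casimir) + (1 / 8) *\<^sub>C (comult U_H) ^ 2"
    unfolding alg_hom_hahn_alpha[OF hom] eq UU.hahn_alpha_eq casimir_tensor comult_U_gens ..
  show "\<phi> (hahn_beta hahn_A hahn_B hahn_C) =
      (1 / 2) *\<^sub>C ((casimir \<otimes> 1 - 1 \<otimes> casimir) * comult U_H)"
    unfolding alg_hom_hahn_beta[OF hom] eq UU.hahn_beta_eq casimir_tensor comult_U_gens ..
qed

end
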